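(* Let $G$ be the grid graph $(\mathbb{Z}^2,\ell^1)$: its vertex set is $\mathbb{Z}^2$ and two vertices are joined by an edge if and only if they differ by $1$ in exactly one coordinate (and agree in the other). Let $v_1, v_2, v_3, \dots$ be the spiral enumeration of $\mathbb{Z}^2$: $v_1=(0,0)$, and the sequence then traces a counterclockwise square spiral obtained by moving, one lattice step at a time, right $1$, up $1$, left $2$, down $2$, right $3$, up $3$, left $4$, down $4$, and so on (so $v_2=(1,0)$, $v_3=(1,1)$, $v_4=(0,1)$, $v_5=(-1,1)$, $v_6=(-1,0)$, $v_7=(-1,-1)$, $v_8=(0,-1)$, $v_9=(1,-1)$, $v_{10}=(2,-1)$, $v_{11}=(2,0)$, $v_{12}=(2,1)$, $v_{13}=(2,2)$, $v_{14}=(1,2)$, $v_{15}=(0,2)$, $v_{16}=(-1,2)$, $\dots$). For $f:\mathbb{Z}^2\to\mathbb{R}_{\ge 0}$ let $f^*$ be its spiral rearrangement, i.e. $f^*(v_k)$ is the $k$-th largest value assumed by $f$. Then $$\|\nabla f^*\|_{L^1}\le \|\nabla f\|_{L^1}\qquad\text{and}\qquad \|\nabla f^*\|_{L^\infty}\le 2\,\|\nabla f\|_{L^\infty}.$$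
   Context: For a graph $G=(V,E)$ and $g:V\to\mathbb{R}$: $\|\nabla g\|_{L^p}^p=\sum_{(v,w)\in E}|g(v)-g(w)|^p$ for $1\le p<\infty$ (each edge counted once), and $\|\nabla g\|_{L^\infty}=\sup_{(v,w)\in E}|g(v)-g(w)|$. Given an enumeration (permutation) $v_1,v_2,\dots$ of $V$, the associated rearrangement of a nonnegative function $f$ is $f^*$ defined by $f^*(v_k)=$ the $k$-th largest value assumed by $f$ (values counted with multiplicity). *)

theory Defs
  imports "HOL-Analysis.Analysis"
begin

definition grid_adj :: "int \<times> int \<Rightarrow> int \<times> int \<Rightarrow> bool" where
  "grid_adj v w \<longleftrightarrow>
     (\<bar>fst v - fst w\<bar> = 1 \<and> snd v = snd w) \<or> (fst v = fst w \<and> \<bar>snd v - snd w\<bar> = 1)"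

text \<open>Every edge is listed once, as the ordered pair pointing right or up
  (see \<open>grid_edges_once\<close>).\<close>

definition grid_edges :: "((int \<times> int) \<times> (int \<times> int)) set" where
  "grid_edges = {(v, w). grid_adj v w \<and> fst v \<le> fst w \<and> snd v \<le> snd w}"

lemma grid_edges_once:
  "grid_adj v w \<longleftrightarrow> ((v, w) \<in> grid_edges) \<noteq> ((w, v) \<in> grid_edges)"
proof -
  have "\<bar>a - b\<bar> = 1 \<longleftrightarrow> a = b + 1 \<or> b = a + 1" for a b :: int by linarith
  then show ?thesis
    by (cases v; cases w) (auto simp: grid_adj_def grid_edges_def)
qed

text \<open>The gradient norms may be infinite, hence the values in \<^typ>\<open>ennreal\<close>.\<close>

definition grad_L1 :: "('a \<times> 'a) set \<Rightarrow> ('a \<Rightarrow> real) \<Rightarrow> ennreal" where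
  "grad_L1 E g = (\<Sum>\<^sub>\<infinity>(v, w)\<in>E. ennreal \<bar>g v - g w\<bar>)"

definition grad_Linf :: "('a \<times> 'a) set \<Rightarrow> ('a \<Rightarrow> real) \<Rightarrow> ennreal" where
  "grad_Linf E g = (SUP (v, w)\<in>E. ennreal \<bar>g v - g w\<bar>)"

text \<open>The legs of the spiral are numbered from 0 and have lengths 1, 1, 2, 2, 3, 3, ...\<close>

definition spiral_leg :: "nat \<Rightarrow> (int \<times> int) list" where
  "spiral_leg m = replicate (m div 2 + 1) ([(1, 0), (0, 1), (-1, 0), (0, -1)] ! (m mod 4))"

text \<open>\<^term>\<open>spiral k\<close> is the vertex $v_k$ for $k \ge 1$, reached from the origin after
  $k - 1$ steps; the first $k$ legs contain at least $k$ steps. The value at 0 is irrelevant.\<close>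

definition spiral :: "nat \<Rightarrow> int \<times> int" where
  "spiral k = sum_list (take (k - 1) (concat (map spiral_leg [0..<k])))"

lemma spiral_initial:
  "map spiral [1..<17] =
    [(0,0), (1,0), (1,1), (0,1), (-1,1), (-1,0), (-1,-1), (0,-1), (1,-1),
     (2,-1), (2,0), (2,1), (2,2), (1,2), (0,2), (-1,2)]"
  by code_simp

text \<open>\<open>t\<close> is the \<open>k\<close>-th largest value assumed by \<open>f\<close>, with multiplicity: fewer than \<open>k\<close> points
  have a value above \<open>t\<close>, and at least \<open>k\<close> points (possibly infinitely many) have a value of
  at least \<open>t\<close>.\<close>

definition kth_largest :: "('a \<Rightarrow> real) \<Rightarrow> nat \<Rightarrow> real \<Rightarrow> bool" where
  "kth_largest f k t \<longleftrightarrow>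
     finite {x. t < f x} \<and> card {x. t < f x} < k \<and>
     (infinite {x. t \<le> f x} \<or> k \<le> card {x. t \<le> f x})"

lemma kth_largest_assumed:
  assumes "kth_largest f k t"
  shows "t \<in> range f"
proof (rule ccontr)
  assume "t \<notin> range f"
  then have "{x. t < f x} = {x. t \<le> f x}"
    by (auto simp: order.order_iff_strict)
  with assms show False
    by (auto simp: kth_largest_def)
qed

lemma kth_largest_unique:
  assumes "kth_largest f k s" "kth_largest f k t"
  shows "s = t"
proof -
  have False if "kth_largest f k s" "kth_largest f k t" "s < t" for s t
  proof -
    have "{x. t \<le> f x} \<subseteq> {x. s < f x}" using that(3) by auto
    with that(1) have "finite {x. t \<le> f x}" "card {x. t \<le> f x} < k"
      using card_mono[of "{x. s < f x}" "{x. t \<le> f x}"]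
      by (auto simp: kth_largest_def intro: finite_subset)
    with that(2) show False by (simp add: kth_largest_def)
  qed
  from this[of s t] this[of t s] assms show ?thesis by (cases s t rule: linorder_cases) auto
qed

lemma kth_largest_exists:
  fixes f :: "'a \<Rightarrow> real"
  assumes inf: "infinite (UNIV :: 'a set)"
    and nonneg: "\<And>x. 0 \<le> f x"
    and vanish: "\<And>t. 0 < t \<Longrightarrow> finite {x. t < f x}"
    and k: "0 < k"
  shows "\<exists>t. kth_largest f k t"
proof (cases "finite {x. 0 < f x} \<and> card {x. 0 < f x} < k")
  case True
  with inf nonneg have "kth_largest f k 0"
    by (simp add: kth_largest_def)
  then show ?thesis ..
next
  case False
  then obtain A where A: "A \<subseteq> {x. 0 < f x}" "finite A" "card A = k"
    using infinite_arbitrarily_large[of "{x. 0 < f x}" k]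
      obtain_subset_with_card_n[of k "{x. 0 < f x}"] by (metis not_less)
  with k have "A \<noteq> {}" by auto
  define m where "m = Min (f ` A)"
  have m: "0 < m" "A \<subseteq> {x. m \<le> f x}"
    using A \<open>A \<noteq> {}\<close> by (auto simp: m_def)
  have fin: "finite {x. s \<le> f x}" if "m \<le> s" for s
    by (rule finite_subset[OF _ vanish[of "m / 2"]]) (use m that in auto)
  define T where "T = {s \<in> f ` {x. m \<le> f x}. k \<le> card {x. s \<le> f x}}"
  have "m \<in> f ` A"
    unfolding m_def by (rule Min_in) (use A \<open>A \<noteq> {}\<close> in auto)
  moreover have "k \<le> card {x. m \<le> f x}"
    using card_mono[OF fin[OF order_refl] m(2)] A by simp
  ultimately have "T \<noteq> {}" "finite T"
    using m(2) fin[OF order_refl] by (auto simp: T_def)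
  define t where "t = Max T"
  have t: "t \<in> T" unfolding t_def by (rule Max_in) fact+
  then have "m \<le> t" "k \<le> card {x. t \<le> f x}" by (auto simp: T_def)
  have fin': "finite {x. t < f x}"
    by (rule finite_subset[OF _ fin[OF \<open>m \<le> t\<close>]]) auto
  have "card {x. t < f x} < k"
  proof (rule ccontr)
    assume *: "\<not> card {x. t < f x} < k"
    define t' where "t' = Min (f ` {x. t < f x})"
    have ne: "{x. t < f x} \<noteq> {}" 
    proof
      assume "{x. t < f x} = {}"
      then have "card {x. t < f x} = 0" by (simp only: card.empty)
      with * k show False by linarith
    qed
    then have t': "t' \<in> f ` {x. t < f x}"
      unfolding t'_def by (intro Min_in) (use fin' in auto)
    have "{x. t' \<le> f x} = {x. t < f x}"
    proof (rule equalityI; rule subsetI)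
      fix x assume "x \<in> {x. t' \<le> f x}"
      with t' show "x \<in> {x. t < f x}" by auto
    next
      fix x assume "x \<in> {x. t < f x}"
      with fin' show "x \<in> {x. t' \<le> f x}" by (simp add: t'_def)
    qed
    with t' have "t' \<in> T" "t < t'"
      using * \<open>m \<le> t\<close> by (auto simp: T_def)
    with Max_ge[OF \<open>finite T\<close> \<open>t' \<in> T\<close>] show False by (simp add: t_def)
  qed
  with fin' \<open>k \<le> card {x. t \<le> f x}\<close> show ?thesis
    by (auto simp: kth_largest_def)
qed

text \<open>\<open>fs\<close> is the rearrangement of \<open>f\<close> along the enumeration $v_1, v_2, \ldots$. For a bijective
  enumeration it exists exactly when \<open>f\<close> has a \<open>k\<close>-th largest value for every $k \ge 1$, which holds in particular for all
  nonnegative \<open>f\<close> vanishing at infinity (\<open>kth_largest_exists\<close>), and it is then unique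
  (\<open>kth_largest_unique\<close>).\<close>

definition is_rearrangement :: "(nat \<Rightarrow> 'a) \<Rightarrow> ('a \<Rightarrow> real) \<Rightarrow> ('a \<Rightarrow> real) \<Rightarrow> bool" where
  "is_rearrangement v f fs \<longleftrightarrow> (\<forall>k\<ge>1. kth_largest f k (fs (v k)))"

end

theory Submission
  imports Defs
begin

text \<open>
  By the coarea formula, the \<open>L\<^sup>1\<close> inequality reduces to superlevel sets: among the sets of
  \<open>n\<close> points, the first \<open>n\<close> points of the spiral have the fewest boundary edges. A finite set whose
  projections have \<open>a\<close> and \<open>b\<close> points has at least \<open>2 (a + b)\<close> boundary edges, where \<open>a b \<ge> n\<close>; a
  segment of the spiral meets its rows and columns in intervals, which gives equality, and its
  bounding box has the least possible \<open>a + b\<close>.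

  For the \<open>L\<^sup>\<infinity>\<close> inequality, a set of \<open>n\<close> points with \<open>n \<le> m\<^sup>2\<close>, \<open>m = max a b\<close>, has at least
  \<open>n + 4 m + 4\<close> points at distance at most 2, while the index along the spiral grows by at
  most \<open>4 m + 4\<close> from the point with index \<open>n\<close> to a neighbour. Two steps in the graph of \<open>f\<close> thus
  suffice for one step in the graph of \<open>f\<^sup>*\<close>, hence the factor 2.
\<close>

subsection \<open>The coarea formula\<close>

text \<open>Turns the sum over edges in \<open>grad_L1\<close> into an integral, so that Tonelli's
  theorem becomes available.\<close>

lemma infsum_eq_nn_integral_count_space:
  fixes f :: "'a \<Rightarrow> ennreal"
  assumes "countable A"
  shows "infsum f A = (\<integral>\<^sup>+x. f x \<partial>count_space A)"
proof (cases "finite A")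
  case True
  then show ?thesis by (simp add: nn_integral_count_space_finite)
next
  case False
  define h where "h = from_nat_into A"
  have h: "bij_betw h UNIV A"
    unfolding h_def using assms False by (rule bij_betw_from_nat_into)
  have "infsum f A = infsum (f \<circ> h) UNIV"
    by (simp add: infsum_reindex_bij_betw[OF h] o_def)
  also have "\<dots> = (\<Sum>n. f (h n))"
    using sums_unique[OF has_sum_imp_sums[OF has_sum_infsum[OF nonneg_summable_on_complete]], of "f \<circ> h"]
    by (simp add: o_def)
  also have "\<dots> = (\<integral>\<^sup>+x. f x \<partial>count_space A)"
    by (simp add: nn_integral_count_space_nat flip: nn_integral_bij_count_space[OF h])
  finally show ?thesis .
qed

definition edge_boundary :: "('a \<times> 'a) set \<Rightarrow> 'a set \<Rightarrow> ('a \<times> 'a) set" where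
  "edge_boundary E A = {(v, w) \<in> E. (v \<in> A) \<noteq> (w \<in> A)}"

lemma edge_boundary_subset: "edge_boundary E A \<subseteq> E"
  by (auto simp: edge_boundary_def)

text \<open>The difference along an edge is the length of the set of levels \<open>t\<close> whose
  superlevel set contains exactly one of its ends; sum and integral are then exchanged. With
  \<open>emeasure\<close> in place of \<open>card\<close>, an infinite boundary counts as
  infinity.\<close>

lemma grad_L1_coarea:
  assumes "countable E"
  shows "grad_L1 E g = (\<integral>\<^sup>+t. emeasure (count_space E) (edge_boundary E {x. t < g x}) \<partial>lborel)"
proof -
  \<comment> \<open>Half-open to match the strict superlevel sets: \<open>t < g x\<close> holds at
    exactly one end iff min \<le> \<open>t\<close> < max.\<close>
  let ?I = "\<lambda>e t. indicator {min (g (fst e)) (g (snd e))..<max (g (fst e)) (g (snd e))} t :: ennreal"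
  have "grad_L1 E g = (\<integral>\<^sup>+e. ennreal \<bar>g (fst e) - g (snd e)\<bar> \<partial>count_space E)"
    by (simp add: grad_L1_def case_prod_beta infsum_eq_nn_integral_count_space[OF assms])
  also have "\<dots> = (\<integral>\<^sup>+e. (\<integral>\<^sup>+t. ?I e t \<partial>lborel) \<partial>count_space E)"
    by (intro nn_integral_cong) (auto simp: min_def max_def)
  also have "\<dots> = (\<integral>\<^sup>+t. (\<integral>\<^sup>+e. ?I e t \<partial>count_space E) \<partial>lborel)"
    by (rule nn_integral_count_space_nn_integral[symmetric]) (use assms in auto)
  also have "\<dots> = (\<integral>\<^sup>+t. emeasure (count_space E) (edge_boundary E {x. t < g x}) \<partial>lborel)"
  proof (rule nn_integral_cong)
    fix t
    have "(\<integral>\<^sup>+e. ?I e t \<partial>count_space E)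
        = (\<integral>\<^sup>+e. indicator (edge_boundary E {x. t < g x}) e \<partial>count_space E)"
      by (intro nn_integral_cong) (auto simp: edge_boundary_def min_def max_def split: split_indicator)
    also have "\<dots> = emeasure (count_space E) (edge_boundary E {x. t < g x})"
      by (rule nn_integral_indicator) (auto simp: edge_boundary_def)
    finally show "(\<integral>\<^sup>+e. ?I e t \<partial>count_space E) = \<dots>" .
  qed
  finally show ?thesis .
qed

subsection \<open>Isoperimetric inequalities on the grid\<close>

definition exposed :: "'a::plus set \<Rightarrow> 'a \<Rightarrow> 'a set" where
  "exposed A d = {v \<in> A. v + d \<notin> A}"

text \<open>Every fibre of \<open>h\<close> meeting \<open>A\<close> contributes its \<open>\<phi>\<close>-maximal point.\<close>

lemma card_image_le_exposed:
  fixes \<phi> :: "'a::plus \<Rightarrow> int"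
  assumes "finite A" "\<And>v. \<phi> v < \<phi> (v + d)" "\<And>v. h (v + d) = h v"
  shows "card (h ` A) \<le> card (exposed A d)"
proof -
  have "h ` A \<subseteq> h ` exposed A d"
  proof
    fix c assume "c \<in> h ` A"
    then have ne: "{v \<in> A. h v = c} \<noteq> {}" by auto
    have fin: "finite {v \<in> A. h v = c}" using assms(1) by simp
    obtain w where w: "w \<in> A" "h w = c" "\<And>v. v \<in> A \<Longrightarrow> h v = c \<Longrightarrow> \<phi> v \<le> \<phi> w"
      using Max_in[of "\<phi> ` {v \<in> A. h v = c}"] Max_ge[of "\<phi> ` {v \<in> A. h v = c}"] ne fin
      by (fastforce simp del: Max_ge)
    have "w + d \<notin> A" using w(3)[of "w + d"] w(2) assms(2)[of w] assms(3)[of w] by auto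
    with w show "c \<in> h ` exposed A d" by (auto simp: exposed_def)
  qed
  moreover have "finite (exposed A d)" using assms(1) by (simp add: exposed_def)
  ultimately show ?thesis by (meson card_image_le card_mono finite_imageI le_trans)
qed

text \<open>The translate adds exactly the points \<open>v + d\<close> with \<open>v\<close>
  exposed, and there is at least one such \<open>v\<close> per fibre of \<open>h\<close>.\<close>

lemma card_union_shift:
  fixes \<phi> :: "'a::ab_group_add \<Rightarrow> int"
  assumes "finite A" "\<And>v. \<phi> v < \<phi> (v + d)" "\<And>v. h (v + d) = h v"
  shows "card A + card (h ` A) \<le> card (A \<union> (\<lambda>v. v + d) ` A)"
proof -
  have "A \<union> (\<lambda>v. v + d) ` A = A \<union> (\<lambda>v. v + d) ` exposed A d"
    by (auto simp: exposed_def)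
  moreover have "card (A \<union> (\<lambda>v. v + d) ` exposed A d) = card A + card (exposed A d)"
    using assms(1) by (subst card_Un_disjoint) (auto simp: exposed_def card_image)
  ultimately show ?thesis using card_image_le_exposed[of A \<phi> d h] assms by simp
qed

section \<open>Vertex isoperimetry: growth of neighbourhoods\<close>

definition grid_nbhd :: "(int \<times> int) set \<Rightarrow> (int \<times> int) set" where
  "grid_nbhd A = A \<union> {w. \<exists>v\<in>A. grid_adj v w}"

lemma grid_adj_iff:
  "grid_adj v w \<longleftrightarrow> w = v + (1, 0) \<or> w = v + (-1, 0) \<or> w = v + (0, 1) \<or> w = v + (0, -1)"
proof -
  have "\<bar>a - b\<bar> = 1 \<longleftrightarrow> b = a + 1 \<or> b = a - 1" for a b :: int by linarith
  then show ?thesis by (cases v; cases w) (auto simp: grid_adj_def)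
qed

lemma grid_nbhd_eq:
  "grid_nbhd A = A \<union> (\<lambda>v. v + (1, 0)) ` A \<union> (\<lambda>v. v + (-1, 0)) ` A
      \<union> (\<lambda>v. v + (0, 1)) ` A \<union> (\<lambda>v. v + (0, -1)) ` A"
  by (auto simp only: grid_nbhd_def grid_adj_iff)

lemma finite_grid_nbhd: "finite A \<Longrightarrow> finite (grid_nbhd A)"
  by (simp add: grid_nbhd_eq)

text \<open>\<open>card_union_shift\<close> is applied twice. Shifting \<open>?U\<close> by
  \<open>- d\<close> only gives back \<open>A\<close> and its translate by \<open>- d\<close>, and
  \<open>?U\<close> has the same image under \<open>h\<close> as \<open>A\<close>. The second shift
  uses \<open>- \<phi>\<close>, which increases along \<open>- d\<close>.\<close>

lemma card_union_two_shifts: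
  fixes \<phi> :: "'a::ab_group_add \<Rightarrow> int"
  assumes "finite A" "\<And>v. \<phi> v < \<phi> (v + d)" "\<And>v. h (v + d) = h v"
    and "A \<union> (\<lambda>v. v + d) ` A \<union> (\<lambda>v. v + - d) ` A \<subseteq> B" "finite B"
  shows "card A + 2 * card (h ` A) \<le> card B"
proof -
  let ?U = "A \<union> (\<lambda>v. v + d) ` A"
  have "h ` ?U = h ` A" using assms(3) by force
  moreover have "h (v + - d) = h v" for v using assms(3)[of "v + - d"] by simp
  moreover have "- \<phi> v < - \<phi> (v + - d)" for v using assms(2)[of "v + - d"] by simp
  ultimately have "card ?U + card (h ` A) \<le> card (?U \<union> (\<lambda>v. v + - d) ` ?U)"
    using card_union_shift[of ?U "\<lambda>v. - \<phi> v" "- d" h] assms(1) by simp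
  also have "\<dots> \<le> card B" using assms(4,5) by (intro card_mono) auto
  finally show ?thesis using card_union_shift[of A \<phi> d h] assms(1-3) by simp
qed

lemma card_grid_nbhd:
  assumes "finite A"
  shows "card A + 2 * card (fst ` A) \<le> card (grid_nbhd A)"
    and "card A + 2 * card (snd ` A) \<le> card (grid_nbhd A)"
  using card_union_two_shifts[of A snd "(0, 1)" fst "grid_nbhd A"]
    card_union_two_shifts[of A fst "(1, 0)" snd "grid_nbhd A"] assms finite_grid_nbhd[OF assms]
  by (auto simp: grid_nbhd_eq)

lemma card_projections_grid_nbhd:
  assumes "finite A" "A \<noteq> {}"
  shows "card (fst ` A) + 2 \<le> card (fst ` grid_nbhd A)"
    and "card (snd ` A) + 2 \<le> card (snd ` grid_nbhd A)"
proof -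
  have 1: "card C + 2 \<le> card D"
    if "C \<union> (\<lambda>v. v + 1) ` C \<union> (\<lambda>v. v + - 1) ` C \<subseteq> D" "finite C" "finite D" "C \<noteq> {}"
    for C D :: "int set"
    \<comment> \<open>With a constant \<open>h\<close>, all of \<open>C\<close> is a single fibre,
      which gains a point for each of the two shifts.\<close>
    using card_union_two_shifts[of C "\<lambda>x. x" 1 "\<lambda>_. 0 :: int" D] that by (simp add: card_gt_0_iff image_constant_conv)
  show "card (fst ` A) + 2 \<le> card (fst ` grid_nbhd A)" "card (snd ` A) + 2 \<le> card (snd ` grid_nbhd A)"
    by (rule 1; use assms finite_grid_nbhd[OF assms(1)] in \<open>force simp: grid_nbhd_eq image_Un image_image\<close>)+
qed

lemma card_le_card_projections:
  assumes "finite A"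
  shows "card A \<le> card (fst ` A) * card (snd ` A)"
proof -
  have "A \<subseteq> fst ` A \<times> snd ` A" by force
  then show ?thesis using card_mono[of "fst ` A \<times> snd ` A" A] assms by (simp add: card_cartesian_product)
qed

text \<open>Let \<open>m\<close> be the size of the larger projection. The first neighbourhood adds
  \<open>2 * m\<close> points and widens the projections by 2, so the second adds
  \<open>2 * (m + 2)\<close>.\<close>

lemma card_grid_nbhd_twice:
  assumes "finite A" "A \<noteq> {}"
  shows "\<exists>m. card A \<le> m\<^sup>2 \<and> card A + 4 * m + 4 \<le> card (grid_nbhd (grid_nbhd A))"
proof -
  let ?m = "max (card (fst ` A)) (card (snd ` A))"
  have "card (fst ` A) * card (snd ` A) \<le> ?m\<^sup>2"
    unfolding power2_eq_square by (intro mult_mono) auto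
  then have "card A \<le> ?m\<^sup>2" using card_le_card_projections[OF assms(1)] by linarith
  moreover have "card A + 4 * ?m + 4 \<le> card (grid_nbhd (grid_nbhd A))"
    using card_grid_nbhd[OF assms(1)] card_grid_nbhd[OF finite_grid_nbhd[OF assms(1)]]
      card_projections_grid_nbhd[OF assms] by linarith
  ultimately show ?thesis by blast
qed

section \<open>Edge isoperimetry\<close>

lemma grid_edges_iff: "(v, w) \<in> grid_edges \<longleftrightarrow> w = v + (1, 0) \<or> w = v + (0, 1)"
  by (cases v) (auto simp: grid_edges_def grid_adj_iff)

text \<open>An edge in direction \<open>d\<close> with one end in \<open>A\<close> has either its
  tail exposed towards \<open>d\<close> or its head exposed towards \<open>- d\<close>;
  \<open>cut d\<close> collects these edges.\<close>

lemma card_grid_edge_boundary: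
  assumes "finite A"
  shows "finite (edge_boundary grid_edges A)"
    and "card (edge_boundary grid_edges A) =
      card (exposed A (1, 0)) + card (exposed A (-1, 0)) + card (exposed A (0, 1)) + card (exposed A (0, -1))"
proof -
  define cut where "cut d = {(v, w). w = v + d \<and> (v \<in> A) \<noteq> (w \<in> A)}" for d
  have eq: "edge_boundary grid_edges A = cut (1, 0) \<union> cut (0, 1)"
    by (auto simp: edge_boundary_def grid_edges_iff cut_def)
  have disj: "cut (1, 0) \<inter> cut (0, 1) = {}"
    by (auto simp: cut_def)
  have fin: "finite (exposed A d)" for d using assms by (simp add: exposed_def)
  have cut: "finite (cut d) \<and> card (cut d) = card (exposed A d) + card (exposed A (- d))" for d
  proof -
    let ?out = "(\<lambda>v. (v, v + d)) ` exposed A d" and ?in = "(\<lambda>w. (w - d, w)) ` exposed A (- d)"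
    have "cut d = ?out \<union> ?in"
    proof (intro set_eqI iffI)
      fix e assume "e \<in> cut d"
      then obtain v where e: "e = (v, v + d)" and v: "(v \<in> A) \<noteq> (v + d \<in> A)"
        by (auto simp: cut_def)
      show "e \<in> ?out \<union> ?in"
      proof (cases "v \<in> A")
        case True
        then show ?thesis using v by (simp add: e exposed_def image_iff)
      next
        case False
        then have "v + d \<in> exposed A (- d)" using v by (simp add: exposed_def)
        then show ?thesis unfolding e by (intro UnI2 image_eqI[of _ _ "v + d"]) simp_all
      qed
    qed (auto simp: cut_def exposed_def)
    moreover have "?out \<inter> ?in = {}" by (auto simp: exposed_def)
    moreover have "card ?out = card (exposed A d)" "card ?in = card (exposed A (- d))"
      by (auto intro!: card_image inj_onI)
    ultimately show ?thesis using fin by (simp add: card_Un_disjoint)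
  qed
  show "finite (edge_boundary grid_edges A)" by (simp add: eq cut)
  show "card (edge_boundary grid_edges A) =
      card (exposed A (1, 0)) + card (exposed A (-1, 0)) + card (exposed A (0, 1)) + card (exposed A (0, -1))"
    using cut[of "(1, 0)"] cut[of "(0, 1)"] disj by (simp add: eq card_Un_disjoint)
qed

text \<open>Every row and every column meeting \<open>A\<close> has a point exposed in each of its
  two directions.\<close>

lemma card_grid_edge_boundary_ge:
  assumes "finite A"
  shows "2 * (card (fst ` A) + card (snd ` A)) \<le> card (edge_boundary grid_edges A)"
  using card_image_le_exposed[OF assms, of fst "(1, 0)" snd]
    card_image_le_exposed[OF assms, of "\<lambda>v. - fst v" "(-1, 0)" snd]
    card_image_le_exposed[OF assms, of snd "(0, 1)" fst]
    card_image_le_exposed[OF assms, of "\<lambda>v. - snd v" "(0, -1)" fst]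
  by (simp add: card_grid_edge_boundary[OF assms])

subsection \<open>The index along the spiral\<close>

text \<open>Closed form of the inverse of \<^const>\<open>spiral\<close>, on the bottom, right, top and left sides of the
  concentric squares in this order.\<close>

fun spiral_index :: "int \<times> int \<Rightarrow> int" where
  "spiral_index (x, y) =
    (if y \<le> x \<and> x \<le> - y then 4 * y\<^sup>2 - 3 * y + 1 + x
     else if y \<le> x then 4 * x\<^sup>2 - 3 * x + 1 + y
     else if - y \<le> x then 4 * y\<^sup>2 - y + 1 - x
     else 4 * x\<^sup>2 - x + 1 - y)"

declare spiral_index.simps [simp del]

lemma square_plus_one: "(x + 1)\<^sup>2 = x\<^sup>2 + 2 * x + (1::int)"
  and square_minus_one: "(x - 1)\<^sup>2 = x\<^sup>2 - 2 * x + (1::int)"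
  by (simp_all add: power2_eq_square algebra_simps)

text \<open>The spiral runs right along bottom sides and left along top sides, and passing to a
  larger square raises the index. Hence each row has its minimum on the diagonal
  \<open>x = y\<close>.\<close>

lemma spiral_index_row:
  shows "y \<le> x \<Longrightarrow> spiral_index (x, y) < spiral_index (x + 1, y)"
    and "x < y \<Longrightarrow> spiral_index (x + 1, y) < spiral_index (x, y)"
proof -
  show "spiral_index (x, y) < spiral_index (x + 1, y)" if *: "y \<le> x"
  proof -
    \<comment> \<open>Each case fixes the sides on which the two points lie, corners included; the
      difference of the closed forms is then linear.\<close>
    consider "y \<le> x \<and> x + 1 \<le> - y" | "x = - y \<and> y \<le> 0"
      | "y \<le> x \<and> - y < x"
      using * by atomize_elim presburger
    then show ?thesis
      by cases (safe, simp_all add: spiral_index.simps power2_eq_square algebra_simps)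
  qed
  show "spiral_index (x + 1, y) < spiral_index (x, y)" if *: "x < y"
  proof -
    consider "x + 1 < y \<and> - y \<le> x" | "y = x + 1 \<and> 0 \<le> x"
      | "x + 1 < y \<and> x + 1 < - y" | "y = - x - 1 \<and> x + 1 < y"
      | "y = x + 1 \<and> x < 0"
      using * by atomize_elim presburger
    then show ?thesis
      by cases (safe, simp_all add: spiral_index.simps power2_eq_square algebra_simps)
  qed
qed

text \<open>\<open>c\<close> is where the spiral first enters column \<open>x\<close>. For
  \<open>1 \<le> x\<close> this is one above the antidiagonal, because the bottom leg runs one step
  past the corner before turning up.\<close>

lemma spiral_index_column:
  fixes x y :: int
  defines "c \<equiv> if 1 \<le> x then - x + 1 else - x"
  shows "c \<le> y \<Longrightarrow> spiral_index (x, y) < spiral_index (x, y + 1)"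
    and "y < c \<Longrightarrow> spiral_index (x, y + 1) < spiral_index (x, y)"
proof -
  show "spiral_index (x, y) < spiral_index (x, y + 1)" if *: "c \<le> y"
  proof -
    consider "1 \<le> x \<and> - x < y \<and> y + 1 \<le> x" | "y = x \<and> 1 \<le> x"
      | "x < y \<and> - y \<le> x" | "x = 0 \<and> y = 0"
      using * unfolding c_def by atomize_elim presburger
    then show ?thesis
      by cases (safe, simp_all add: spiral_index.simps power2_eq_square algebra_simps)
  qed
  show "spiral_index (x, y + 1) < spiral_index (x, y)" if *: "y < c"
  proof -
    consider "1 \<le> x \<and> y + 1 \<le> - x" | "y = - x \<and> 1 \<le> x"
      | "x \<le> 0 \<and> y + 1 \<le> x" | "y = x \<and> x < 0" | "x < y \<and> y + 1 < - x"
      | "y = - x - 1 \<and> x < y"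
      using * unfolding c_def by atomize_elim presburger
    then show ?thesis
      by cases (safe, simp_all add: spiral_index.simps power2_eq_square algebra_simps)
  qed
qed

section \<open>Unimodal functions on the integers\<close>

lemma unimodal_ge:
  fixes g :: "int \<Rightarrow> int"
  assumes "\<And>x. c \<le> x \<Longrightarrow> g x < g (x + 1)" "c \<le> x" "x \<le> x'"
  shows "g x \<le> g x'"
  using assms(3)
proof (induction x' rule: int_ge_induct)
  case (step i)
  then show ?case using assms(1)[of i] assms(2) by simp
qed simp

lemma unimodal_min:
  fixes g :: "int \<Rightarrow> int"
  assumes "\<And>x. c \<le> x \<Longrightarrow> g x < g (x + 1)" "\<And>x. x < c \<Longrightarrow> g (x + 1) < g x"
  shows "g c \<le> g x"
proof (cases "c \<le> x")
  case True
  then show ?thesis using unimodal_ge[of c g c x] assms(1) by blast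
next
  case False
  \<comment> \<open>Reflection turns the decreasing half into an increasing one.\<close>
  have "g (- (- c)) \<le> g (- (- x))"
  proof (rule unimodal_ge[where g = "\<lambda>x. g (- x)" and c = "- c"])
    show "g (- x) < g (- (x + 1))" if "- c \<le> x" for x
      using assms(2)[of "- x - 1"] that by simp
  qed (use False in auto)
  then show ?thesis by simp
qed

text \<open>Sublevel sets are intervals, so they have only one right end: the function can rise
  above \<open>n\<close> only at or after \<open>c\<close>, and never returns.\<close>

lemma unimodal_last_unique:
  fixes g :: "int \<Rightarrow> int"
  assumes "\<And>x. c \<le> x \<Longrightarrow> g x < g (x + 1)" "\<And>x. x < c \<Longrightarrow> g (x + 1) < g x"
    and "g x \<le> n" "n < g (x + 1)" "g x' \<le> n" "n < g (x' + 1)"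
  shows "x = x'"
proof -
  have "c \<le> x" "c \<le> x'" using assms(2)[of x] assms(2)[of x'] assms(3-6) by linarith+
  then have "\<not> x + 1 \<le> x'" "\<not> x' + 1 \<le> x"
    using unimodal_ge[of c g "x + 1" x', OF assms(1)] unimodal_ge[of c g "x' + 1" x, OF assms(1)] assms(3-6)
    by force+
  then show ?thesis by simp
qed

lemma unimodal_first_unique:
  fixes g :: "int \<Rightarrow> int"
  assumes "\<And>x. c \<le> x \<Longrightarrow> g x < g (x + 1)" "\<And>x. x < c \<Longrightarrow> g (x + 1) < g x"
    and "g x \<le> n" "n < g (x - 1)" "g x' \<le> n" "n < g (x' - 1)"
  shows "x = x'"
proof -
  have "- x = - x'"
  proof (rule unimodal_last_unique[where g = "\<lambda>x. g (- x)" and c = "- c" and n = n])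
    show "g (- x) < g (- (x + 1))" if "- c \<le> x" for x
      using assms(2)[of "- x - 1"] that by simp
    show "g (- (x + 1)) < g (- x)" if "x < - c" for x
      using assms(1)[of "- x - 1"] that by simp
  qed (use assms(3-6) in simp_all)
  then show ?thesis by simp
qed

text \<open>The bound is the index at which the spiral first enters row \<open>y\<close>, namely at
  \<open>(y, y)\<close>.\<close>

lemma spiral_index_ge_row: "4 * y\<^sup>2 - 2 * y + 1 \<le> spiral_index (x, y)"
proof -
  have "spiral_index (y, y) \<le> spiral_index (x, y)"
    by (rule unimodal_min[where c = y and g = "\<lambda>x. spiral_index (x, y)"]; rule spiral_index_row)
  moreover have "spiral_index (y, y) = 4 * y\<^sup>2 - 2 * y + 1"
    by (simp add: spiral_index.simps)
  ultimately show ?thesis by simp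
qed

lemma spiral_index_ge_column:
  "(if 1 \<le> x then 4 * x\<^sup>2 - 4 * x + 2 else 4 * x\<^sup>2 + 1) \<le> spiral_index (x, y)"
proof -
  let ?c = "if 1 \<le> x then - x + 1 else - x"
  have "spiral_index (x, ?c) \<le> spiral_index (x, y)"
    by (rule unimodal_min[where c = ?c and g = "\<lambda>y. spiral_index (x, y)"]; rule spiral_index_column)
  moreover have "spiral_index (x, - x + 1) = 4 * x\<^sup>2 - 4 * x + 2" if "1 \<le> x"
    using that by (simp add: spiral_index.simps)
  moreover have "spiral_index (x, - x) = 4 * x\<^sup>2 + 1" if "\<not> 1 \<le> x"
    using that by (simp add: spiral_index.simps)
  ultimately show ?thesis by (simp split: if_splits)
qed

lemma spiral_index_pos: "1 \<le> spiral_index p"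
proof (cases p)
  case (Pair x y)
  have "0 \<le> y * (2 * y - 1)" by (auto simp: zero_le_mult_iff)
  then have "0 \<le> 4 * y\<^sup>2 - 2 * y" by (simp add: power2_eq_square algebra_simps)
  then show ?thesis using spiral_index_ge_row[of y x] Pair by simp
qed

lemma quadratic_mono:
  fixes b y :: int
  assumes "1 \<le> b" "b \<le> y"
  shows "b\<^sup>2 \<le> y\<^sup>2" "2 * b\<^sup>2 - b \<le> 2 * y\<^sup>2 - y" "b\<^sup>2 - b \<le> y\<^sup>2 - y"
  using mult_mono[of b y b y] mult_mono[of b y "2 * b - 1" "2 * y - 1"] mult_mono[of b y "b - 1" "y - 1"] assms
  by (simp_all add: power2_eq_square algebra_simps)

text \<open>Each bound is the number of points of the rectangle. The next row or column is first
  entered at exactly one more than this number, so an index within the bound cannot lie outside. The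
  four cases are the stages of one round.\<close>

lemma spiral_index_box:
  fixes q :: int
  assumes "0 \<le> q"
  shows "spiral_index (x, y) \<le> 2 * q * (2 * q + 1) \<Longrightarrow> - q \<le> x \<and> x \<le> q \<and> - q + 1 \<le> y \<and> y \<le> q"
    and "spiral_index (x, y) \<le> (2 * q + 1)\<^sup>2 \<Longrightarrow> - q \<le> x \<and> x \<le> q \<and> - q \<le> y \<and> y \<le> q"
    and "spiral_index (x, y) \<le> (2 * q + 1) * (2 * q + 2) \<Longrightarrow> - q \<le> x \<and> x \<le> q + 1 \<and> - q \<le> y \<and> y \<le> q"
    and "spiral_index (x, y) \<le> (2 * q + 2)\<^sup>2 \<Longrightarrow> - q \<le> x \<and> x \<le> q + 1 \<and> - q \<le> y \<and> y \<le> q + 1"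
proof -
  have up: "y < b \<or> 4 * b\<^sup>2 - 2 * b + 1 \<le> spiral_index (x, y)" if "1 \<le> b" for b
  proof (cases "y < b")
    case False
    then have "b \<le> y" by simp
    from quadratic_mono[OF that this] spiral_index_ge_row[of y x] that this show ?thesis by (auto split: if_splits)
  qed simp
  have right: "x < b \<or> 4 * b\<^sup>2 - 4 * b + 2 \<le> spiral_index (x, y)" if "1 \<le> b" for b
  proof (cases "x < b")
    case False
    then have "b \<le> x" by simp
    from quadratic_mono[OF that this] spiral_index_ge_column[of x y] that this show ?thesis by (auto split: if_splits)
  qed simp
  have left: "- b < x \<or> 4 * b\<^sup>2 + 1 \<le> spiral_index (x, y)" if "1 \<le> b" for b
  proof (cases "- b < x")
    case False
    then have "b \<le> - x" by simp
    from quadratic_mono[OF that this] spiral_index_ge_column[of x y] that this show ?thesis by (auto split: if_splits)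
  qed simp
  have down: "- b < y \<or> 4 * b\<^sup>2 + 2 * b + 1 \<le> spiral_index (x, y)" if "1 \<le> b" for b
  proof (cases "- b < y")
    case False
    then have "b \<le> - y" by simp
    from quadratic_mono[OF that this] spiral_index_ge_row[of y x] that this show ?thesis by (auto split: if_splits)
  qed simp
  \<comment> \<open>\<open>down\<close> requires a positive argument; for \<open>q = 0\<close> the
    bound is just positivity of the index.\<close>
  have down': "- q < y \<or> 4 * q\<^sup>2 + 2 * q + 1 \<le> spiral_index (x, y)"
    using down[of q] spiral_index_pos[of "(x, y)"] assms by (cases "q = 0") auto
  have [simp]: "(q + 2)\<^sup>2 = q\<^sup>2 + 4 * q + 4" by (simp add: power2_eq_square algebra_simps)
  note * = up[of "q + 1"] up[of "q + 2"] right[of "q + 1"] right[of "q + 2"] left[of "q + 1"]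
    down[of "q + 1"] down'
  show "spiral_index (x, y) \<le> 2 * q * (2 * q + 1) \<Longrightarrow> - q \<le> x \<and> x \<le> q \<and> - q + 1 \<le> y \<and> y \<le> q"
    "spiral_index (x, y) \<le> (2 * q + 1)\<^sup>2 \<Longrightarrow> - q \<le> x \<and> x \<le> q \<and> - q \<le> y \<and> y \<le> q"
    "spiral_index (x, y) \<le> (2 * q + 1) * (2 * q + 2) \<Longrightarrow> - q \<le> x \<and> x \<le> q + 1 \<and> - q \<le> y \<and> y \<le> q"
    "spiral_index (x, y) \<le> (2 * q + 2)\<^sup>2 \<Longrightarrow> - q \<le> x \<and> x \<le> q + 1 \<and> - q \<le> y \<and> y \<le> q + 1"
    using * assms unfolding square_plus_one power_mult_distrib distrib_left distrib_right
    by (simp_all add: power2_eq_square algebra_simps)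
qed

text \<open>A step to the next square costs about 8 times the larger coordinate in absolute value,
  and an index of at most the square of \<open>m\<close> keeps the coordinates near
  \<open>m / 2\<close>.\<close>

lemma spiral_index_adj:
  assumes "grid_adj p p'" "spiral_index p \<le> m\<^sup>2" "0 \<le> m"
  shows "spiral_index p' \<le> spiral_index p + 4 * m + 4"
proof -
  obtain x y where p: "p = (x, y)" by (cases p)
  \<comment> \<open>Used contrapositively: an index above the square of \<open>b\<close> forces
    \<open>b < m\<close>. The values of \<open>b\<close> below are chosen just under the first-entry
    bounds.\<close>
  have m: "spiral_index p \<le> b\<^sup>2 \<or> b < m" for b :: int
    using assms(2,3) power2_less_imp_less[of b m] by linarith
  have "2 * x \<le> m \<and> 2 * y \<le> m \<and> - 2 * x + 1 \<le> m \<and> - 2 * y + 1 \<le> m"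
    using m[of "2 * x - 1"] m[of "2 * y - 1"] m[of "- 2 * x"] m[of "- 2 * y"]
      spiral_index_ge_row[of y x] spiral_index_ge_column[of x y] assms(3)
    unfolding p square_minus_one power_mult_distrib
    by (auto split: if_splits)
  note m = this
  have "spiral_index (x + 1, y) \<le> spiral_index (x, y) + 4 * m + 4"
  proof -
    \<comment> \<open>In each of the four directions, the first case is a step towards the minimum
      of the row or column, where the index drops; the others compare closed forms.\<close>
    consider "x < y" | "y \<le> x \<and> x + 1 \<le> - y" | "x = - y \<and> y \<le> 0"
      | "y \<le> x \<and> - y < x"
      by atomize_elim presburger
    then show ?thesis
    proof cases
      case 1
      from spiral_index_row(2)[where x = x and y = y, OF 1] m show ?thesis by simp
    qed (use m in \<open>safe, simp_all add: spiral_index.simps power2_eq_square algebra_simps\<close>)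
  qed
  moreover have "spiral_index (x - 1, y) \<le> spiral_index (x, y) + 4 * m + 4"
  proof -
    consider "y \<le> x - 1" | "x < y \<and> - y \<le> x - 1" | "y = x \<and> 1 \<le> x"
      | "x < y \<and> x < - y" | "y = - x \<and> x < y" | "y = x \<and> x < 1"
      by atomize_elim presburger
    then show ?thesis
    proof cases
      case 1
      from spiral_index_row(1)[where x = "x - 1" and y = y, OF 1] m show ?thesis by simp
    qed (use m in \<open>safe, simp_all add: spiral_index.simps power2_eq_square algebra_simps\<close>)
  qed
  moreover have "spiral_index (x, y + 1) \<le> spiral_index (x, y) + 4 * m + 4"
  proof -
    consider "y < (if 1 \<le> x then - x + 1 else - x)"
      | "1 \<le> x \<and> - x < y \<and> y + 1 \<le> x" | "y = x \<and> 1 \<le> x"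
      | "x < y \<and> - y \<le> x" | "x = 0 \<and> y = 0"
      by atomize_elim presburger
    then show ?thesis
    proof cases
      case 1
      from spiral_index_column(2)[where x = x and y = y, OF 1] m show ?thesis by simp
    qed (use m in \<open>safe, simp_all add: spiral_index.simps power2_eq_square algebra_simps\<close>)
  qed
  moreover have "spiral_index (x, y - 1) \<le> spiral_index (x, y) + 4 * m + 4"
  proof -
    consider "(if 1 \<le> x then - x + 1 else - x) \<le> y - 1" | "1 \<le> x \<and> y \<le> - x"
      | "y = - x + 1 \<and> 1 \<le> x" | "x \<le> 0 \<and> y \<le> x" | "y = x + 1 \<and> x < 0"
      | "x < y - 1 \<and> y < - x" | "y = - x \<and> x < y - 1" | "x = 0 \<and> y = 0"
      by atomize_elim presburger
    then show ?thesis
    proof cases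
      case 1
      from spiral_index_column(1)[where x = x and y = "y - 1", OF 1] m show ?thesis by simp
    qed (use m in \<open>safe, simp_all add: spiral_index.simps power2_eq_square algebra_simps\<close>)
  qed
  moreover have "p' = (x + 1, y) \<or> p' = (x - 1, y) \<or> p' = (x, y + 1) \<or> p' = (x, y - 1)"
    using assms(1) by (cases p') (auto simp: grid_adj_def p)
  ultimately show ?thesis unfolding p by auto
qed

section \<open>The closed form inverts the walk\<close>

abbreviation spiral_legs :: "nat \<Rightarrow> (int \<times> int) list" where
  "spiral_legs m \<equiv> concat (map spiral_leg [0..<m])"

lemma le_length_spiral_legs: "m \<le> length (spiral_legs m)"
  by (induction m) (auto simp: spiral_leg_def)

lemma sum_list_replicate_pair:
  "sum_list (replicate s (a, b)) = (int s * a, int s * b)"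
  by (induction s) (auto simp: zero_prod_def algebra_simps)

text \<open>The \<open>+ 1\<close> reflects that \<open>spiral k\<close> is reached after
  \<open>k - 1\<close> steps. \<open>s\<close> may equal the full length of the leg, so a corner can
  be described from either of its legs.\<close>

lemma spiral_in_leg:
  assumes "s \<le> m div 2 + 1" "k = int (length (spiral_legs m)) + int s + 1"
  shows "spiral (nat k) = sum_list (spiral_legs m) + sum_list (take s (spiral_leg m))"
proof -
  have k: "nat k = Suc (length (spiral_legs m) + s)" using assms(2) by linarith
  \<comment> \<open>Leg \<open>m\<close> is therefore among the \<open>k\<close> legs in the
    definition of \<open>spiral\<close>.\<close>
  then have "m < nat k" using le_length_spiral_legs[of m] by linarith
  then have "[0..<nat k] = [0..<m] @ m # [Suc m..<nat k]"
    by (metis le_add_diff_inverse less_imp_le upt_add_eq_append upt_conv_Cons zero_le)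
  moreover have "length (spiral_leg m) = m div 2 + 1" by (simp add: spiral_leg_def)
  ultimately show ?thesis using assms(1) by (simp add: spiral_def k del: upt_Suc)
qed

lemma spiral_leg_cycle:
  "spiral_leg (4 * q) = replicate (2 * q + 1) (1, 0)"
  "spiral_leg (4 * q + 1) = replicate (2 * q + 1) (0, 1)"
  "spiral_leg (4 * q + 2) = replicate (2 * q + 2) (-1, 0)"
  "spiral_leg (4 * q + 3) = replicate (2 * q + 2) (0, -1)"
proof -
  have 1: "4 * q div 2 = 2 * q" "(4 * q + 1) div 2 = 2 * q"
    "(4 * q + 2) div 2 = 2 * q + 1" "(4 * q + 3) div 2 = 2 * q + 1"
    by presburger+
  have 2: "(4 * q + 1) mod 4 = 1" "(4 * q + 2) mod 4 = 2" "(4 * q + 3) mod 4 = 3"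
    by presburger+
  show "spiral_leg (4 * q) = replicate (2 * q + 1) (1, 0)"
    "spiral_leg (4 * q + 1) = replicate (2 * q + 1) (0, 1)"
    "spiral_leg (4 * q + 2) = replicate (2 * q + 2) (-1, 0)"
    "spiral_leg (4 * q + 3) = replicate (2 * q + 2) (0, -1)"
    unfolding spiral_leg_def 1 2 by simp_all
qed

lemma spiral_legs_Suc: "spiral_legs (m + 1) = spiral_legs m @ spiral_leg m"
  by simp

lemma spiral_legs_plus:
  "spiral_legs (m + 2) = spiral_legs m @ spiral_leg m @ spiral_leg (m + 1)"
  "spiral_legs (m + 3) = spiral_legs m @ spiral_leg m @ spiral_leg (m + 1) @ spiral_leg (m + 2)"
  "spiral_legs (m + 4) = spiral_legs m @ spiral_leg m @ spiral_leg (m + 1) @ spiral_leg (m + 2) @ spiral_leg (m + 3)"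
  by (simp_all add: eval_nat_numeral)

text \<open>Round \<open>q\<close> has legs of lengths \<open>2q+1\<close>, \<open>2q+1\<close>,
  \<open>2q+2\<close>, \<open>2q+2\<close>: it takes \<open>8q+6\<close> steps and moves by
  \<open>(-1, -1)\<close> in total.\<close>

lemma spiral_legs_four_times:
  "int (length (spiral_legs (4 * q))) = 4 * (int q)\<^sup>2 + 2 * int q \<and>
   sum_list (spiral_legs (4 * q)) = (- int q, - int q)"
proof (induction q)
  case 0
  then show ?case by (simp add: zero_prod_def)
next
  case (Suc q)
  have "4 * Suc q = 4 * q + 4" by simp
  then show ?case
    using Suc unfolding \<open>4 * Suc q = 4 * q + 4\<close> spiral_legs_plus spiral_leg_cycle
    by (simp add: sum_list_replicate_pair power2_eq_square algebra_simps del: replicate_Suc replicate.simps)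
qed

lemma spiral_cycle:
  fixes s q :: nat
  shows "s \<le> 2 * q + 1 \<Longrightarrow> spiral (nat (4 * (int q)\<^sup>2 + 2 * int q + int s + 1)) = (int s - int q, - int q)"
    and "s \<le> 2 * q + 1 \<Longrightarrow> spiral (nat (4 * (int q)\<^sup>2 + 4 * int q + int s + 2)) = (int q + 1, int s - int q)"
    and "s \<le> 2 * q + 2 \<Longrightarrow> spiral (nat (4 * (int q)\<^sup>2 + 6 * int q + int s + 3)) = (int q + 1 - int s, int q + 1)"
    and "s \<le> 2 * q + 2 \<Longrightarrow> spiral (nat (4 * (int q)\<^sup>2 + 8 * int q + int s + 5)) = (- int q - 1, int q + 1 - int s)"
proof -
  note L = spiral_legs_four_times[THEN conjunct1, of q] and S = spiral_legs_four_times[THEN conjunct2, of q]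
  note leg = spiral_legs_plus spiral_legs_Suc spiral_leg_cycle
  show "spiral (nat (4 * (int q)\<^sup>2 + 2 * int q + int s + 1)) = (int s - int q, - int q)" if "s \<le> 2 * q + 1"
    by (subst spiral_in_leg[of s "4 * q"]; (unfold leg)?)
       (use that in \<open>simp_all add: L S sum_list_replicate_pair min_def del: replicate_Suc\<close>)
  show "spiral (nat (4 * (int q)\<^sup>2 + 4 * int q + int s + 2)) = (int q + 1, int s - int q)" if "s \<le> 2 * q + 1"
    by (subst spiral_in_leg[of s "4 * q + 1"]; (unfold leg)?)
       (use that in \<open>simp_all add: L S sum_list_replicate_pair min_def del: replicate_Suc\<close>)
  show "spiral (nat (4 * (int q)\<^sup>2 + 6 * int q + int s + 3)) = (int q + 1 - int s, int q + 1)" if "s \<le> 2 * q + 2"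
    by (subst spiral_in_leg[of s "4 * q + 2"]; (unfold leg)?)
       (use that in \<open>simp_all add: L S sum_list_replicate_pair min_def del: replicate_Suc\<close>)
  show "spiral (nat (4 * (int q)\<^sup>2 + 8 * int q + int s + 5)) = (- int q - 1, int q + 1 - int s)" if "s \<le> 2 * q + 2"
    by (subst spiral_in_leg[of s "4 * q + 3"]; (unfold leg)?)
       (use that in \<open>simp_all add: L S sum_list_replicate_pair min_def del: replicate_Suc\<close>)
qed

text \<open>The side determines the round: \<open>q\<close> is \<open>- y\<close>,
  \<open>x - 1\<close>, \<open>y - 1\<close> or \<open>- x - 1\<close> on the bottom, right, top or
  left, and \<open>s\<close> is the distance from the start of that leg.\<close>

lemma spiral_spiral_index: "spiral (nat (spiral_index p)) = p"
proof (cases p)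
  case (Pair x y)
  consider "y \<le> x \<and> x \<le> - y" | "y \<le> x \<and> - y < x"
      | "x < y \<and> - y \<le> x" | "x < y \<and> x < - y" by atomize_elim presburger
  then show ?thesis
  proof cases
    case 1
    then have "nat (x - y) \<le> 2 * nat (- y) + 1" by linarith
    from spiral_cycle(1)[OF this] 1 show ?thesis
      unfolding Pair by (simp add: spiral_index.simps algebra_simps)
  next
    case 2
    then have "nat (y + x - 1) \<le> 2 * nat (x - 1) + 1" by linarith
    from spiral_cycle(2)[OF this] 2 show ?thesis
      unfolding Pair by (simp add: spiral_index.simps square_minus_one algebra_simps)
  next
    case 3
    then have "nat (y - x) \<le> 2 * nat (y - 1) + 2" by linarith
    from spiral_cycle(3)[OF this] 3 show ?thesis
      unfolding Pair by (simp add: spiral_index.simps square_minus_one algebra_simps)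
  next
    case 4
    then have "nat (- x - y) \<le> 2 * nat (- x - 1) + 2" by linarith
    from spiral_cycle(4)[OF this] 4 show ?thesis
      unfolding Pair by (simp add: spiral_index.simps power2_eq_square algebra_simps)
  qed
qed

subsection \<open>Initial segments of the spiral\<close>

definition spiral_segment :: "int \<Rightarrow> (int \<times> int) set" where
  "spiral_segment n = {p. spiral_index p \<le> n}"

text \<open>By unimodality the segment meets every row and column in an interval, so each row and
  column of the box has at most one exposed point per direction.\<close>

lemma card_boundary_spiral_segment_le:
  assumes "spiral_segment n \<subseteq> X \<times> Y" "finite X" "finite Y"
  shows "card (edge_boundary grid_edges (spiral_segment n)) \<le> 2 * (card X + card Y)"
proof -
  have fin: "finite (spiral_segment n)" using assms by (meson finite_SigmaI finite_subset)
  have Y: "card (exposed (spiral_segment n) d) \<le> card Y" if "inj_on snd (exposed (spiral_segment n) d)" for d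
    by (rule card_inj_on_le[OF that]) (use assms in \<open>auto simp: exposed_def\<close>)
  have X: "card (exposed (spiral_segment n) d) \<le> card X" if "inj_on fst (exposed (spiral_segment n) d)" for d
    by (rule card_inj_on_le[OF that]) (use assms in \<open>auto simp: exposed_def\<close>)
  have right: "x = x'" if "spiral_index (x, y) \<le> n" "n < spiral_index (x + 1, y)"
      "spiral_index (x', y) \<le> n" "n < spiral_index (x' + 1, y)" for x x' y
    by (rule unimodal_last_unique[where g = "\<lambda>x. spiral_index (x, y)" and c = y and n = n];
      (rule spiral_index_row | fact that))
  have left: "x = x'" if "spiral_index (x, y) \<le> n" "n < spiral_index (x - 1, y)"
      "spiral_index (x', y) \<le> n" "n < spiral_index (x' - 1, y)" for x x' y
    by (rule unimodal_first_unique[where g = "\<lambda>x. spiral_index (x, y)" and c = y and n = n];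
      (rule spiral_index_row | fact that))
  have up: "y = y'" if "spiral_index (x, y) \<le> n" "n < spiral_index (x, y + 1)"
      "spiral_index (x, y') \<le> n" "n < spiral_index (x, y' + 1)" for x y y'
    by (rule unimodal_last_unique[where g = "\<lambda>y. spiral_index (x, y)" and c = "if 1 \<le> x then - x + 1 else - x" and n = n];
      (rule spiral_index_column | fact that))
  have down: "y = y'" if "spiral_index (x, y) \<le> n" "n < spiral_index (x, y - 1)"
      "spiral_index (x, y') \<le> n" "n < spiral_index (x, y' - 1)" for x y y'
    by (rule unimodal_first_unique[where g = "\<lambda>y. spiral_index (x, y)" and c = "if 1 \<le> x then - x + 1 else - x" and n = n];
      (rule spiral_index_column | fact that))
  have "inj_on snd (exposed (spiral_segment n) (1, 0))"
    by (auto simp: inj_on_def exposed_def spiral_segment_def not_le intro: right)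
  moreover have "inj_on snd (exposed (spiral_segment n) (-1, 0))"
    by (auto simp: inj_on_def exposed_def spiral_segment_def not_le intro: left)
  moreover have "inj_on fst (exposed (spiral_segment n) (0, 1))"
    by (auto simp: inj_on_def exposed_def spiral_segment_def not_le intro: up)
  moreover have "inj_on fst (exposed (spiral_segment n) (0, -1))"
    by (auto simp: inj_on_def exposed_def spiral_segment_def not_le intro: down)
  ultimately show ?thesis
    using Y[of "(1, 0)"] Y[of "(-1, 0)"] X[of "(0, 1)"] X[of "(0, -1)"]
    by (simp add: card_grid_edge_boundary[OF fin])
qed

text \<open>AM-GM in the form \<open>4ab \<le> (a + b)^2\<close>; the pronic version below also uses
  that \<open>(2m + 1)^2\<close> exceeds \<open>4m(m + 1)\<close> by only 1.\<close>

lemma sum_gt_of_square_lt_mult: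
  fixes a b m :: nat
  assumes "m\<^sup>2 < a * b"
  shows "2 * m + 1 \<le> a + b"
proof (rule ccontr)
  assume "\<not> 2 * m + 1 \<le> a + b"
  then have "(a + b)\<^sup>2 \<le> (2 * m)\<^sup>2" by (intro power_mono) auto
  moreover have "4 * (a * b) \<le> (a + b)\<^sup>2"
    using sum_squares_ge_zero[of "int a - int b" 0]
    by (simp add: power2_eq_square algebra_simps flip: of_nat_le_iff[where 'a = int])
  ultimately show False using assms by (simp add: power_mult_distrib)
qed

lemma sum_gt_of_pronic_lt_mult:
  fixes a b m :: nat
  assumes "m * (m + 1) < a * b"
  shows "2 * m + 2 \<le> a + b"
proof (rule ccontr)
  assume "\<not> 2 * m + 2 \<le> a + b"
  then have "(a + b)\<^sup>2 \<le> (2 * m + 1)\<^sup>2" by (intro power_mono) auto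
  moreover have "4 * (a * b) \<le> (a + b)\<^sup>2"
    using sum_squares_ge_zero[of "int a - int b" 0]
    by (simp add: power2_eq_square algebra_simps flip: of_nat_le_iff[where 'a = int])
  ultimately show False using assms by (simp add: power2_eq_square algebra_simps)
qed

lemma ex_square_bracket:
  fixes n :: nat
  assumes "0 < n"
  shows "\<exists>m. m\<^sup>2 < n \<and> n \<le> (m + 1)\<^sup>2"
proof -
  define k where "k = (LEAST k. n \<le> k\<^sup>2)"
  have "n \<le> k\<^sup>2" unfolding k_def by (rule LeastI[of _ n]) (simp add: power2_nat_le_imp_le power2_eq_square)
  moreover from this assms obtain m where "k = m + 1" by (cases k) auto
  moreover have "\<not> n \<le> m\<^sup>2" using \<open>k = m + 1\<close> not_less_Least[of m "\<lambda>k. n \<le> k\<^sup>2"] by (simp add: k_def)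
  ultimately show ?thesis by (metis not_le)
qed

lemma finite_spiral_segment: "finite (spiral_segment n)"
proof -
  have "n \<le> (2 * \<bar>n\<bar> + 1)\<^sup>2"
    using self_le_power[of "2 * \<bar>n\<bar> + 1" 2] by linarith
  then have "- \<bar>n\<bar> \<le> x \<and> x \<le> \<bar>n\<bar> \<and> - \<bar>n\<bar> \<le> y \<and> y \<le> \<bar>n\<bar>"
    if "spiral_index (x, y) \<le> n" for x y
    using spiral_index_box(2)[of "\<bar>n\<bar>" x y] that by simp
  then have "spiral_segment n \<subseteq> {- \<bar>n\<bar>..\<bar>n\<bar>} \<times> {- \<bar>n\<bar>..\<bar>n\<bar>}"
    by (auto simp: spiral_segment_def)
  then show ?thesis by (rule finite_subset) simp
qed

text \<open>The bounding boxes of the segments are squares or differ from a square by one row; by AM-GM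
  a set of the same size cannot have a smaller sum of projections.\<close>

lemma spiral_segment_isoperimetric:
  assumes "finite A"
  shows "card (edge_boundary grid_edges (spiral_segment (int (card A)))) \<le> card (edge_boundary grid_edges A)"
proof (cases "card A = 0")
  case True
  have "\<not> spiral_index p \<le> 0" for p using spiral_index_pos[of p] by linarith
  then have "spiral_segment 0 = {}" by (simp add: spiral_segment_def)
  then show ?thesis using True by (simp add: edge_boundary_def)
next
  case False
  define n a b where "n = int (card A)" and "a = card (fst ` A)" and "b = card (snd ` A)"
  have ab: "card A \<le> a * b" "2 * (a + b) \<le> card (edge_boundary grid_edges A)"
    using assms card_le_card_projections card_grid_edge_boundary_ge by (auto simp: a_def b_def)
  have seg: "card (edge_boundary grid_edges (spiral_segment n)) \<le> 2 * (nat (x2 - x1 + 1) + nat (y2 - y1 + 1))"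
    if "\<And>x y. spiral_index (x, y) \<le> n \<Longrightarrow> x1 \<le> x \<and> x \<le> x2 \<and> y1 \<le> y \<and> y \<le> y2" for x1 x2 y1 y2
  proof -
    have "spiral_segment n \<subseteq> {x1..x2} \<times> {y1..y2}" using that by (auto simp: spiral_segment_def)
    from card_boundary_spiral_segment_le[OF this] show ?thesis by simp
  qed
  \<comment> \<open>The box has sides \<open>m\<close> and \<open>m + 1\<close> if
    \<open>n \<le> m * (m + 1)\<close>, and is a square of side \<open>m + 1\<close>
    otherwise.\<close>
  obtain m where m: "m\<^sup>2 < card A" "card A \<le> (m + 1)\<^sup>2"
    using ex_square_bracket False by blast
  have ge1: "2 * m + 1 \<le> a + b"
    using m(1) ab(1) by (intro sum_gt_of_square_lt_mult) linarith
  have ge2: "2 * m + 2 \<le> a + b" if "m * (m + 1) < card A"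
    using that ab(1) by (intro sum_gt_of_pronic_lt_mult) linarith
  have up: "n \<le> (int m + 1)\<^sup>2" using m(2) unfolding n_def by (metis of_nat_1 of_nat_add of_nat_le_iff of_nat_power)
  have pronic: "n \<le> int m * (int m + 1)" if "\<not> m * (m + 1) < card A"
    using that unfolding n_def by (metis not_less of_nat_1 of_nat_add of_nat_le_iff of_nat_mult)
  \<comment> \<open>The parity of \<open>m\<close> selects the stage of round \<open>q\<close>, and
    so the position of the box.\<close>
  obtain q where q: "m = 2 * q \<or> m = 2 * q + 1" by (metis oddE evenE)
  let ?q = "int q"
  have "card (edge_boundary grid_edges (spiral_segment n)) \<le> 2 * (a + b)"
  proof (cases "m * (m + 1) < card A"; cases "m = 2 * q")
    assume *: "m * (m + 1) < card A" and "m = 2 * q"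
    then have m': "m = 2 * q" using q by simp
    have "- ?q \<le> x \<and> x \<le> ?q \<and> - ?q \<le> y \<and> y \<le> ?q" if "spiral_index (x, y) \<le> n" for x y
      using spiral_index_box(2)[of ?q x y] up that by (simp add: m' add.commute)
    from seg[OF this] show ?thesis using ge2[OF *] m' by simp
  next
    assume *: "m * (m + 1) < card A" and "m \<noteq> 2 * q"
    then have m': "m = 2 * q + 1" using q by simp
    have "- ?q \<le> x \<and> x \<le> ?q + 1 \<and> - ?q \<le> y \<and> y \<le> ?q + 1" if "spiral_index (x, y) \<le> n" for x y
      using spiral_index_box(4)[of ?q x y] up that by (simp add: m' add.commute)
    from seg[OF this] show ?thesis using ge2[OF *] m' by simp
  next
    assume *: "\<not> m * (m + 1) < card A" and "m = 2 * q"
    then have m': "m = 2 * q" using q by simp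
    have "- ?q \<le> x \<and> x \<le> ?q \<and> - ?q + 1 \<le> y \<and> y \<le> ?q" if "spiral_index (x, y) \<le> n" for x y
      using spiral_index_box(1)[of ?q x y] pronic[OF *] that by (simp add: m' add.commute)
    from seg[OF this] show ?thesis using ge1 m' by simp
  next
    assume *: "\<not> m * (m + 1) < card A" and "m \<noteq> 2 * q"
    then have m': "m = 2 * q + 1" using q by simp
    have "- ?q \<le> x \<and> x \<le> ?q + 1 \<and> - ?q \<le> y \<and> y \<le> ?q" if "spiral_index (x, y) \<le> n" for x y
      using spiral_index_box(3)[of ?q x y] pronic[OF *] that by (simp add: m' add.commute)
    from seg[OF this] show ?thesis using ge1 m' by simp
  qed
  then show ?thesis using ab(2) by (simp add: n_def)
qed

subsection \<open>The rearrangement\<close>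

context
  fixes f fs :: "int \<times> int \<Rightarrow> real"
  assumes rearr: "is_rearrangement spiral f fs"
begin

lemma kth_largest_spiral_index: "kth_largest f (nat (spiral_index p)) (fs p)"
proof -
  have "1 \<le> nat (spiral_index p)" using spiral_index_pos[of p] by linarith
  with rearr show ?thesis
    unfolding is_rearrangement_def using spiral_spiral_index[of p] by metis
qed

text \<open>The \<open>k\<close>-th largest value exceeds \<open>t\<close> iff at least
  \<open>k\<close> points have values above \<open>t\<close>.\<close>

lemma superlevel_rearrangement:
  assumes "finite {x. t < f x}"
  shows "{x. t < fs x} = spiral_segment (int (card {x. t < f x}))"
proof (rule set_eqI)
  fix p
  let ?k = "nat (spiral_index p)"
  have "t < fs p \<longleftrightarrow> ?k \<le> card {x. t < f x}"
  proof
    assume "t < fs p"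
    then have sub: "{x. fs p \<le> f x} \<subseteq> {x. t < f x}" by auto
    then show "?k \<le> card {x. t < f x}"
      using kth_largest_spiral_index[of p] card_mono[OF assms sub] finite_subset[OF sub assms]
      by (auto simp: kth_largest_def)
  next
    assume *: "?k \<le> card {x. t < f x}"
    show "t < fs p"
    proof (rule ccontr)
      assume "\<not> t < fs p"
      then have "{x. t < f x} \<subseteq> {x. fs p < f x}" by auto
      with kth_largest_spiral_index[of p] * show False
        using card_mono[of "{x. fs p < f x}" "{x. t < f x}"] by (auto simp: kth_largest_def)
    qed
  qed
  then show "p \<in> {x. t < fs x} \<longleftrightarrow> p \<in> spiral_segment (int (card {x. t < f x}))"
    by (auto simp: spiral_segment_def)
qed

text \<open>Covers, for instance, all \<open>t < 0\<close> when \<open>f\<close> is nonnegative; the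
  superlevel set of \<open>fs\<close> then has empty boundary.\<close>

lemma superlevel_rearrangement_infinite:
  assumes "infinite {x. t < f x}"
  shows "{x. t < fs x} = UNIV"
proof -
  have "t < fs p" for p
  proof (rule ccontr)
    assume "\<not> t < fs p"
    then have "{x. t < f x} \<subseteq> {x. fs p < f x}" by auto
    with kth_largest_spiral_index[of p] assms show False
      by (auto simp: kth_largest_def dest: finite_subset)
  qed
  then show ?thesis by simp
qed

lemma grad_L1_rearrangement_le: "grad_L1 grid_edges fs \<le> grad_L1 grid_edges f"
proof -
  have "emeasure (count_space grid_edges) (edge_boundary grid_edges {x. t < fs x})
      \<le> emeasure (count_space grid_edges) (edge_boundary grid_edges {x. t < f x})" for t
  proof (cases "finite {x. t < f x}")
    case True
    then show ?thesis
      using spiral_segment_isoperimetric[OF True] card_grid_edge_boundary(1)[OF True]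
        card_grid_edge_boundary(1)[OF finite_spiral_segment]
      by (simp add: superlevel_rearrangement emeasure_count_space edge_boundary_subset)
  next
    case False
    then show ?thesis by (simp add: superlevel_rearrangement_infinite edge_boundary_def)
  qed
  then show ?thesis
    by (simp add: grad_L1_coarea nn_integral_mono)
qed

text \<open>Otherwise all points within two steps of the \<open>k\<close> points chosen for
  \<open>p\<close> have values above \<open>fs p'\<close>. There are at least
  \<open>k + 4 * m + 4\<close> of them, so \<open>p'\<close> comes too late in the spiral to be
  adjacent to \<open>p\<close>.\<close>

lemma rearrangement_diff_le:
  assumes lip: "\<And>v w. grid_adj v w \<Longrightarrow> \<bar>f v - f w\<bar> \<le> l" and "grid_adj p p'"
  shows "fs p - fs p' \<le> 2 * l"
proof (rule ccontr)
  assume "\<not> fs p - fs p' \<le> 2 * l"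
  define k where "k = nat (spiral_index p)"
  have k: "int k = spiral_index p" "0 < k" using spiral_index_pos[of p] by (auto simp: k_def)
  \<comment> \<open>The set of points with value at least \<open>fs p\<close> may be infinite or too
    large; exactly \<open>k\<close> of them are kept to match the index of \<open>p\<close>.\<close>
  obtain A where A: "A \<subseteq> {x. fs p \<le> f x}" "finite A" "card A = k"
    using kth_largest_spiral_index[of p] infinite_arbitrarily_large[of "{x. fs p \<le> f x}" k]
      obtain_subset_with_card_n[of k "{x. fs p \<le> f x}"]
    unfolding kth_largest_def k_def by metis
  from A(3) k(2) have "A \<noteq> {}" by auto
  then obtain m where m: "k \<le> m\<^sup>2" "k + 4 * m + 4 \<le> card (grid_nbhd (grid_nbhd A))"
    using card_grid_nbhd_twice[OF A(2)] A(3) by auto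
  have nbhd: "grid_nbhd B \<subseteq> {x. t - l \<le> f x}" if "B \<subseteq> {x. t \<le> f x}" for B t
  proof
    fix w assume "w \<in> grid_nbhd B"
    then consider "w \<in> B" | v where "v \<in> B" "grid_adj v w" by (auto simp: grid_nbhd_def)
    then show "w \<in> {x. t - l \<le> f x}"
    proof cases
      case 1
      \<comment> \<open>The given edge itself shows that the bound \<open>l\<close> is
        nonnegative.\<close>
      have "0 \<le> l" using lip[OF assms(2)] by linarith
      then show ?thesis using 1 that by auto
    next
      case 2
      then show ?thesis using lip[of v w] that by force
    qed
  qed
  have "grid_nbhd (grid_nbhd A) \<subseteq> {x. fs p' < f x}"
    using nbhd[OF nbhd[OF A(1)]] \<open>\<not> fs p - fs p' \<le> 2 * l\<close> by force
  then have "card (grid_nbhd (grid_nbhd A)) < nat (spiral_index p')"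
    using kth_largest_spiral_index[of p'] card_mono[of "{x. fs p' < f x}" "grid_nbhd (grid_nbhd A)"]
    by (auto simp: kth_largest_def)
  moreover have "spiral_index p \<le> (int m)\<^sup>2"
    using m(1) k(1) by (metis of_nat_le_iff of_nat_power)
  then have "spiral_index p' \<le> int k + 4 * int m + 4"
    using spiral_index_adj[OF assms(2), of "int m"] k(1) by simp
  ultimately show False using m(2) by linarith
qed

lemma grad_Linf_rearrangement_le: "grad_Linf grid_edges fs \<le> 2 * grad_Linf grid_edges f"
proof (cases "grad_Linf grid_edges f")
  case (real l)
  have lip: "\<bar>f v - f w\<bar> \<le> l" if "grid_adj v w" for v w
  proof -
    \<comment> \<open>Each edge is listed in one orientation only, so both have to be
      considered.\<close>
    have "(v, w) \<in> grid_edges \<or> (w, v) \<in> grid_edges" using that grid_edges_once by blast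
    then have "ennreal \<bar>f v - f w\<bar> \<le> grad_Linf grid_edges f"
      unfolding grad_Linf_def
      by (auto simp: abs_minus_commute intro: SUP_upper2[of "(v, w)"] SUP_upper2[of "(w, v)"])
    then show ?thesis using real by simp
  qed
  have "ennreal \<bar>fs v - fs w\<bar> \<le> 2 * ennreal l" if "(v, w) \<in> grid_edges" for v w
  proof -
    have "grid_adj v w" "grid_adj w v" using that by (auto simp: grid_edges_def grid_adj_def)
    then have "\<bar>fs v - fs w\<bar> \<le> 2 * l"
      using rearrangement_diff_le[OF lip, of v w] rearrangement_diff_le[OF lip, of w v] by linarith
    then have "ennreal \<bar>fs v - fs w\<bar> \<le> ennreal (2 * l)" by (rule ennreal_leI)
    then show ?thesis using real by (simp add: ennreal_mult)
  qed
  then show ?thesis using real by (auto simp: grad_Linf_def intro!: SUP_least)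
next
  case top
  then show ?thesis by (simp add: ennreal_mult_top)
qed

end

theorem theorem1:
  fixes f fs :: "int \<times> int \<Rightarrow> real"
  assumes "\<And>x. 0 \<le> f x"
    and "is_rearrangement spiral f fs"
  shows "grad_L1 grid_edges fs \<le> grad_L1 grid_edges f
       \<and> grad_Linf grid_edges fs \<le> 2 * grad_Linf grid_edges f"
  using grad_L1_rearrangement_le[OF assms(2)] grad_Linf_rearrangement_le[OF assms(2)] ..

end
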